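(* Let $\varepsilon>0$ and let $H,K\colon(-\varepsilon;\varepsilon)\to\mathbb{R}$ be real analytic functions with $K(0)<0$. Then $4H(t)^2=-t^2K(t)$ for all $|t|<\varepsilon$ if and only if $H(0)=0$ and $$H^{(m)}=\pm\frac{-mK^{(m-1)}-\frac{4}{m+1}\sum_{r=2}^{m-1}\binom{m+1}{r}H^{(r)}H^{(m-r+1)}}{2^{2-\delta_{m1}}\sqrt{-K^{(0)}}}\qquad\text{for each }m=1,2,\dots,$$ where $H^{(i)}$ and $K^{(i)}$ denote the $i$-th derivatives at $t=0$ and the same choice of sign $\pm$ is used for all $m$.
   Context: $\delta_{mn}=1$ if $m=n$ and $0$ otherwise. An empty sum equals $0$. *)

theory Defs
  imports "HOL-Analysis.Analysis"
begin

definition real_analytic_on :: "(real \<Rightarrow> real) \<Rightarrow> real set \<Rightarrow> bool" where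
  "real_analytic_on f S \<longleftrightarrow>
     (\<forall>x\<in>S. \<exists>r>0. \<exists>a::nat \<Rightarrow> real. \<forall>y. \<bar>y - x\<bar> < r \<longrightarrow> (\<lambda>n. a n * (y - x) ^ n) sums f y)"

definition kdelta :: "nat \<Rightarrow> nat \<Rightarrow> nat" where
  "kdelta m n = (if m = n then 1 else 0)"

end

theory Submission
  imports Defs "HOL-Complex_Analysis.Complex_Analysis"
begin

text \<open>Both sides of \<open>4 H(t)\<^sup>2 = -t\<^sup>2 K(t)\<close> are real analytic on the interval, which is connected,
  so by the identity theorem the equation holds there iff the power series of \<open>4 H\<^sup>2 + t\<^sup>2 K\<close> at 0
  vanishes. Writing \<open>h i\<close>, \<open>k i\<close> for the \<open>i\<close>-th derivatives of \<open>H\<close>, \<open>K\<close> at 0, \<open>n!\<close> times its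
  \<open>n\<close>-th coefficient is \<open>4 \<Sum>\<^sub>i (n choose i) h i h (n - i) + n (n - 1) k (n - 2)\<close>. For \<open>n = 0\<close> this
  gives \<open>h 0 = 0\<close>; for \<open>n = 2\<close> it gives \<open>(2 h 1)\<^sup>2 = -k 0\<close>, i.e. \<open>2 h 1 = \<sigma> \<surd>(-k 0)\<close> for a sign \<open>\<sigma>\<close>;
  and for \<open>n = m + 1 \<ge> 3\<close> the only term containing \<open>h m\<close> is \<open>8 (m + 1) h 1 h m\<close>, so the equation
  can be solved for \<open>h m\<close>, which is the stated recursion.\<close>

lemma openI_eventually_nhds:
  assumes "\<And>x. x \<in> S \<Longrightarrow> eventually (\<lambda>y. y \<in> S) (nhds x)"
  shows "open S"
proof (rule open_subopen[THEN iffD2], intro ballI)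
  fix x assume "x \<in> S"
  then have "eventually (\<lambda>y. y \<in> S) (nhds x)" by (rule assms)
  then obtain T where "open T" "x \<in> T" "\<forall>y\<in>T. y \<in> S"
    unfolding eventually_nhds by blast
  then show "\<exists>T. open T \<and> x \<in> T \<and> T \<subseteq> S" by blast
qed

lemma fps_nth_conv_deriv_real:
  fixes f :: "real fps"
  assumes "fps_conv_radius f > 0"
  shows   "fps_nth f n = (deriv ^^ n) (eval_fps f) 0 / fact n"
  using assms
proof (induction n arbitrary: f)
  case 0
  thus ?case by (simp add: eval_fps_def)
next
  case (Suc n f)
  have "(deriv ^^ Suc n) (eval_fps f) 0 = (deriv ^^ n) (deriv (eval_fps f)) 0"
    unfolding funpow_Suc_right o_def ..
  also have "eventually (\<lambda>z::real. z \<in> eball 0 (fps_conv_radius f)) (nhds 0)"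
    using Suc.prems by (intro eventually_nhds_in_open) (auto simp: zero_ereal_def)
  hence "eventually (\<lambda>z. deriv (eval_fps f) z = eval_fps (fps_deriv f) z) (nhds 0)"
    by eventually_elim (simp add: eval_fps_deriv)
  hence "(deriv ^^ n) (deriv (eval_fps f)) 0 = (deriv ^^ n) (eval_fps (fps_deriv f)) 0"
    by (intro higher_deriv_cong_ev refl)
  also have "\<dots> / fact n = fps_nth (fps_deriv f) n"
    using Suc.prems fps_conv_radius_deriv[of f] by (intro Suc.IH [symmetric]) auto
  also have "\<dots> / of_nat (Suc n) = fps_nth f (Suc n)"
    by (simp add: fps_deriv_def del: of_nat_Suc)
  finally show ?case by (simp add: field_split_simps)
qed

lemma fps_nth_fps_expansion_real:
  fixes f :: "real \<Rightarrow> real"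
  assumes "f has_fps_expansion F"
  shows   "fps_nth F n = (deriv ^^ n) f 0 / fact n"
proof -
  have "fps_nth F n = (deriv ^^ n) (eval_fps F) 0 / fact n"
    using assms by (intro fps_nth_conv_deriv_real) (auto simp: has_fps_expansion_def)
  also have "(deriv ^^ n) (eval_fps F) 0 = (deriv ^^ n) f 0"
    using assms by (intro higher_deriv_cong_ev) (auto simp: has_fps_expansion_def)
  finally show ?thesis .
qed

lemma fps_expansion_unique_real:
  fixes F G :: "real fps"
  assumes "f has_fps_expansion F" "f has_fps_expansion G"
  shows   "F = G"
  using assms by (auto simp: fps_eq_iff fps_nth_fps_expansion_real)

lemma has_fps_expansion_power [fps_expansion_intros]:
  fixes F :: "'a :: {banach, real_normed_div_algebra, comm_ring_1} fps"
  assumes "f has_fps_expansion F"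
  shows "(\<lambda>x. f x ^ n) has_fps_expansion F ^ n"
proof (induction n)
  case (Suc n)
  then show ?case using has_fps_expansion_mult[OF assms Suc.IH] by simp
qed simp

lemma eval_fps_eventually_nonzero:
  fixes F :: "'a::{real_normed_field,banach} fps"
  assumes "fps_conv_radius F > 0" "F \<noteq> 0"
  shows "eventually (\<lambda>z. eval_fps F z \<noteq> 0) (at 0)"
proof (cases "fps_nth F 0 = 0")
  case False
  have "isCont (eval_fps F) 0"
    using assms(1) by (intro continuous_eval_fps) (simp add: zero_ereal_def)
  then show ?thesis
    using False by (intro tendsto_imp_eventually_ne) (auto simp: isCont_def eval_fps_at_0)
next
  case True
  obtain m where m: "fps_nth F m \<noteq> 0" using assms(2) by (metis fps_ext fps_zero_nth)
  with True have "m > 0" by (cases m) auto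
  obtain r :: real where r: "0 < ereal r" "ereal r < fps_conv_radius F"
    using ereal_dense2[OF assms(1)] by (auto simp: zero_ereal_def)
  have sums: "(\<lambda>n. fps_nth F n * (z - 0) ^ n) sums eval_fps F z" if "norm (z - 0) < r" for z
  proof -
    have "ereal (norm z) < ereal r" using that by simp
    then have "ereal (norm z) < fps_conv_radius F" using r(2) by (rule order.strict_trans)
    then show ?thesis using sums_eval_fps[of z F] by simp
  qed
  have "r > 0" "eval_fps F 0 = 0" using r(1) True by (simp_all add: eval_fps_at_0)
  then obtain s where "0 < s" "\<And>z. z \<in> cball 0 s - {0} \<Longrightarrow> eval_fps F z \<noteq> 0"
    using powser_0_nonzero[where a = "fps_nth F", OF _ sums _ m \<open>m > 0\<close>] by blast
  then show ?thesis by (auto simp: eventually_at dist_norm intro!: exI[of _ s])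
qed

lemma real_analytic_on_iff_has_fps_expansion:
  "real_analytic_on f S \<longleftrightarrow> (\<forall>x\<in>S. \<exists>F. (\<lambda>z. f (x + z)) has_fps_expansion F)"
proof (intro iffI ballI)
  fix x assume "real_analytic_on f S" "x \<in> S"
  then obtain r a where r: "r > 0"
    and sums: "\<And>y. \<bar>y - x\<bar> < r \<Longrightarrow> (\<lambda>n. a n * (y - x) ^ n) sums f y"
    unfolding real_analytic_on_def by blast
  have "fps_conv_radius (Abs_fps a) \<ge> ereal r"
    unfolding fps_conv_radius_def
  proof (rule conv_radius_geI_ex')
    fix r' :: real assume "0 < r'" "ereal r' < ereal r"
    then show "summable (\<lambda>n. fps_nth (Abs_fps a) n * of_real r' ^ n)"
      using sums_summable[OF sums[of "x + r'"]] by simp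
  qed
  then have "fps_conv_radius (Abs_fps a) > 0"
    using r by (metis ereal_less(2) order_less_le_trans)
  moreover have "eventually (\<lambda>z. eval_fps (Abs_fps a) z = f (x + z)) (nhds 0)"
    unfolding eventually_nhds_metric dist_real_def
  proof (intro exI[of _ r] conjI allI impI r)
    fix z :: real assume "\<bar>z - 0\<bar> < r"
    then have "(\<lambda>n. a n * z ^ n) sums f (x + z)" using sums[of "x + z"] by simp
    then show "eval_fps (Abs_fps a) z = f (x + z)" by (simp add: eval_fps_def sums_iff)
  qed
  ultimately show "\<exists>F. (\<lambda>z. f (x + z)) has_fps_expansion F"
    unfolding has_fps_expansion_def by blast
next
  assume expansions: "\<forall>x\<in>S. \<exists>F. (\<lambda>z. f (x + z)) has_fps_expansion F"
  show "real_analytic_on f S"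
    unfolding real_analytic_on_def
  proof
    fix x assume "x \<in> S"
    then obtain F where F: "fps_conv_radius F > 0"
      "eventually (\<lambda>z. eval_fps F z = f (x + z)) (nhds 0)"
      using expansions by (auto simp: has_fps_expansion_def)
    obtain d where d: "d > 0" "\<And>z. \<bar>z\<bar> < d \<Longrightarrow> eval_fps F z = f (x + z)"
      using F(2) by (auto simp: eventually_nhds_metric dist_real_def)
    obtain \<rho> :: real where \<rho>: "0 < ereal \<rho>" "ereal \<rho> < fps_conv_radius F"
      using ereal_dense2[OF F(1)] by (auto simp: zero_ereal_def)
    have "(\<lambda>n. fps_nth F n * (y - x) ^ n) sums f y" if "\<bar>y - x\<bar> < min d \<rho>" for y
    proof -
      have "ereal \<bar>y - x\<bar> < ereal \<rho>" using that by simp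
      then have "ereal \<bar>y - x\<bar> < fps_conv_radius F" using \<rho>(2) by (rule order.strict_trans)
      then show ?thesis using sums_eval_fps[of "y - x" F] d(2)[of "y - x"] that by simp
    qed
    then show "\<exists>r>0. \<exists>a. \<forall>y. \<bar>y - x\<bar> < r \<longrightarrow> (\<lambda>n. a n * (y - x) ^ n) sums f y"
      using d(1) \<rho>(1) by (intro exI[of _ "min d \<rho>"]) auto
  qed
qed

lemma real_analytic_on_const: "real_analytic_on (\<lambda>_. c) S"
  unfolding real_analytic_on_iff_has_fps_expansion using has_fps_expansion_const by blast

lemma real_analytic_on_id: "real_analytic_on (\<lambda>x. x) S"
  unfolding real_analytic_on_iff_has_fps_expansion
  using has_fps_expansion_add[OF has_fps_expansion_const has_fps_expansion_fps_X] by blast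

lemma real_analytic_on_add:
  "real_analytic_on f S \<Longrightarrow> real_analytic_on g S \<Longrightarrow> real_analytic_on (\<lambda>x. f x + g x) S"
  unfolding real_analytic_on_iff_has_fps_expansion by (metis has_fps_expansion_add)

lemma real_analytic_on_mult:
  "real_analytic_on f S \<Longrightarrow> real_analytic_on g S \<Longrightarrow> real_analytic_on (\<lambda>x. f x * g x) S"
  unfolding real_analytic_on_iff_has_fps_expansion by (metis has_fps_expansion_mult)

lemma real_analytic_on_power:
  "real_analytic_on f S \<Longrightarrow> real_analytic_on (\<lambda>x. f x ^ n) S"
  unfolding real_analytic_on_iff_has_fps_expansion by (metis has_fps_expansion_power)

lemma real_analytic_on_eventually_nonzero:
  assumes "real_analytic_on g I" "x \<in> I" "\<not> eventually (\<lambda>y. g y = 0) (nhds x)"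
  shows "eventually (\<lambda>y. g y \<noteq> 0) (at x)"
proof -
  obtain G where G: "(\<lambda>z. g (x + z)) has_fps_expansion G"
    using assms(1,2) by (auto simp: real_analytic_on_iff_has_fps_expansion)
  have "G \<noteq> 0"
  proof
    assume "G = 0"
    then have "eventually (\<lambda>z. g (x + z) = 0) (nhds 0)"
      using G by (simp add: has_fps_expansion_0_iff)
    then show False
      using assms(3) by (simp add: nhds_to_0[of x] eventually_filtermap)
  qed
  then have "eventually (\<lambda>z. eval_fps G z \<noteq> 0) (at 0)"
    using G by (intro eval_fps_eventually_nonzero) (auto simp: has_fps_expansion_def)
  moreover have "eventually (\<lambda>z. eval_fps G z = g (x + z)) (at 0)"
    using G by (auto simp: has_fps_expansion_def eventually_at_filter elim: eventually_mono)
  ultimately have "eventually (\<lambda>z. g (x + z) \<noteq> 0) (at 0)"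
    by eventually_elim simp
  then show ?thesis
    by (simp add: eventually_at_to_0[of _ x] add.commute)
qed

lemma real_analytic_continuation:
  assumes "real_analytic_on g I" "open I" "connected I"
    and "x\<^sub>0 \<in> I" "eventually (\<lambda>y. g y = 0) (nhds x\<^sub>0)" "x \<in> I"
  shows "g x = 0"
proof -
  define S where "S = {y \<in> I. eventually (\<lambda>w. g w = 0) (nhds y)}"
  have "open S"
  proof (rule openI_eventually_nhds)
    fix y assume "y \<in> S"
    then have "eventually (\<lambda>w. w \<in> I) (nhds y)"
      and "eventually (\<lambda>w. eventually (\<lambda>v. g v = 0) (nhds w)) (nhds y)"
      using \<open>open I\<close> by (auto simp: S_def eventually_eventually intro: eventually_nhds_in_open)
    then show "eventually (\<lambda>w. w \<in> S) (nhds y)"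
      unfolding S_def mem_Collect_eq by (rule eventually_conj)
  qed
  have "open (I - S)"
  proof (rule openI_eventually_nhds)
    fix y assume y: "y \<in> I - S"
    then have "eventually (\<lambda>w. g w \<noteq> 0) (at y)"
      using assms(1) by (intro real_analytic_on_eventually_nonzero) (auto simp: S_def)
    then have "eventually (\<lambda>w. w \<in> I \<and> eventually (\<lambda>v. v \<noteq> y \<longrightarrow> g v \<noteq> 0) (nhds w)) (nhds y)"
      using eventually_nhds_in_open[OF \<open>open I\<close>, of y] y
      by (auto simp: eventually_at_filter eventually_eventually intro: eventually_conj)
    then show "eventually (\<lambda>w. w \<in> I - S) (nhds y)"
    proof eventually_elim
      case (elim w)
      show "w \<in> I - S"
      proof (cases "w = y")
        case False
        from elim have "eventually (\<lambda>v. v \<noteq> y \<longrightarrow> g v \<noteq> 0) (nhds w)" by simp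
        moreover have "eventually (\<lambda>v. v \<noteq> y) (nhds w)" using False by (rule t1_space_nhds)
        ultimately have "eventually (\<lambda>v. g v \<noteq> 0) (nhds w)" by eventually_elim simp
        then have "\<not> eventually (\<lambda>v. g v = 0) (nhds w)"
          using eventually_conj eventually_happens' by fastforce
        then show ?thesis using elim by (simp add: S_def)
      qed (use y in simp)
    qed
  qed
  have "S \<inter> I = {} \<or> (I - S) \<inter> I = {}"
    by (rule connectedD[OF \<open>connected I\<close> \<open>open S\<close> \<open>open (I - S)\<close>]) (auto simp: S_def)
  moreover have "x\<^sub>0 \<in> S" using assms(4,5) by (simp add: S_def)
  ultimately have "x \<in> S" using assms(4,6) by (auto simp: S_def)
  then show "g x = 0" unfolding S_def using eventually_nhds_x_imp_x by blast
qed

lemma real_analytic_on_eq_0_iff_fps_expansion_eq_0: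
  fixes g :: "real \<Rightarrow> real"
  assumes "real_analytic_on g I" "open I" "connected I" "0 \<in> I" "g has_fps_expansion G"
  shows "(\<forall>t\<in>I. g t = 0) \<longleftrightarrow> G = 0"
proof
  assume "\<forall>t\<in>I. g t = 0"
  then have "eventually (\<lambda>t. g t = 0) (nhds 0)"
    using eventually_nhds_in_open[OF assms(2,4)] by (auto elim: eventually_mono)
  then have "g has_fps_expansion 0" by (simp add: has_fps_expansion_0_iff)
  then show "G = 0" using assms(5) by (rule fps_expansion_unique_real[symmetric])
next
  assume "G = 0"
  then have "eventually (\<lambda>t. g t = 0) (nhds 0)"
    using assms(5) by (simp add: has_fps_expansion_0_iff)
  then show "\<forall>t\<in>I. g t = 0"
    using real_analytic_continuation[OF assms(1-4)] by blast
qed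

definition eqn_coeff :: "(nat \<Rightarrow> real) \<Rightarrow> (nat \<Rightarrow> real) \<Rightarrow> nat \<Rightarrow> real" where
  "eqn_coeff h k n = 4 * (\<Sum>i\<le>n. real (n choose i) * h i * h (n - i)) +
     (if n \<ge> 2 then real n * real (n - 1) * k (n - 2) else 0)"

definition middle_sum :: "(nat \<Rightarrow> real) \<Rightarrow> nat \<Rightarrow> real" where
  "middle_sum h m = (\<Sum>r\<in>{2..m - 1}. real ((m + 1) choose r) * h r * h (m - r + 1))"

definition rec_numerator :: "(nat \<Rightarrow> real) \<Rightarrow> (nat \<Rightarrow> real) \<Rightarrow> nat \<Rightarrow> real" where
  "rec_numerator h k m = - (real m * k (m - 1)) - 4 / real (m + 1) * middle_sum h m"

lemma fact_mult_fps_nth_eqn: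
  fixes FH FK :: "real fps"
  assumes FH: "\<And>i. fps_nth FH i = h i / fact i" and FK: "\<And>i. fps_nth FK i = k i / fact i"
  shows "fact n * fps_nth (fps_const 4 * FH\<^sup>2 + fps_X\<^sup>2 * FK) n = eqn_coeff h k n"
proof -
  have square: "fact n * fps_nth (FH\<^sup>2) n = (\<Sum>i\<le>n. real (n choose i) * h i * h (n - i))"
    unfolding power2_eq_square fps_mult_nth atLeast0AtMost sum_distrib_left
  proof (intro sum.cong refl)
    fix i assume "i \<in> {..n}"
    then have "fact n / (fact i * fact (n - i)) = real (n choose i)"
      by (simp add: binomial_fact)
    then show "fact n * (fps_nth FH i * fps_nth FH (n - i)) = real (n choose i) * h i * h (n - i)"
      by (simp add: FH field_simps)
  qed
  have shifted: "fact n * fps_nth (fps_X\<^sup>2 * FK) n =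
      (if n \<ge> 2 then real n * real (n - 1) * k (n - 2) else 0)"
  proof (cases "n \<ge> 2")
    case True
    then obtain j where n: "n = j + 2" by (metis add.commute le_iff_add)
    have "fact (j + 2) * (k j / fact j) = real (j + 2) * real (j + 1) * k j"
      by (simp add: fact_Suc field_simps numeral_2_eq_2)
    then show ?thesis using n by (simp add: fps_X_power_mult_nth FK)
  qed (simp add: fps_X_power_mult_nth)
  show ?thesis
    using square shifted by (simp add: eqn_coeff_def distrib_left mult.left_commute)
qed

lemma rec_numerator_1: "rec_numerator h k 1 = - k 0"
  by (simp add: rec_numerator_def middle_sum_def)

lemma eqn_coeff_0: "eqn_coeff h k 0 = 4 * (h 0)\<^sup>2"
  by (simp add: eqn_coeff_def power2_eq_square)

lemma eqn_coeff_1: "eqn_coeff h k 1 = 8 * h 0 * h 1"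
  by (simp add: eqn_coeff_def)

lemma eqn_coeff_2: "h 0 = 0 \<Longrightarrow> eqn_coeff h k 2 = 2 * ((2 * h 1)\<^sup>2 + k 0)"
  by (simp add: eqn_coeff_def numeral_2_eq_2 power2_eq_square)

lemma eqn_coeff_Suc:
  assumes "h 0 = 0" "m \<ge> 2"
  shows "eqn_coeff h k (m + 1) = real (m + 1) * (8 * h 1 * h m - rec_numerator h k m)"
proof -
  have split: "{..m+1} = {0, 1, m, m+1} \<union> {2..m-1}" using assms(2) by auto
  have "(\<Sum>i\<le>m+1. real ((m+1) choose i) * h i * h (m + 1 - i)) =
     (\<Sum>i\<in>{0, 1, m, m+1}. real ((m+1) choose i) * h i * h (m + 1 - i)) +
     (\<Sum>i\<in>{2..m-1}. real ((m+1) choose i) * h i * h (m + 1 - i))"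
    unfolding split by (rule sum.union_disjoint) auto
  also have "(\<Sum>i\<in>{0, 1, m, m+1}. real ((m+1) choose i) * h i * h (m + 1 - i)) =
      2 * real (m + 1) * h 1 * h m"
    using assms by simp
  also have "(\<Sum>i\<in>{2..m-1}. real ((m+1) choose i) * h i * h (m + 1 - i)) = middle_sum h m"
    unfolding middle_sum_def by (intro sum.cong refl) (auto simp: Suc_diff_le)
  finally show ?thesis
    using assms by (simp add: eqn_coeff_def rec_numerator_def field_simps)
qed

lemma eqn_coeffs_eq_0_iff:
  "(\<forall>n. eqn_coeff h k n = 0) \<longleftrightarrow>
     h 0 = 0 \<and> (2 * h 1)\<^sup>2 = - k 0 \<and> (\<forall>m\<ge>2. 8 * h 1 * h m = rec_numerator h k m)"
proof
  assume all: "\<forall>n. eqn_coeff h k n = 0"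
  then have h0: "h 0 = 0" by (metis eqn_coeff_0 zero_eq_power2 mult_eq_0_iff zero_neq_numeral)
  moreover have "(2 * h 1)\<^sup>2 = - k 0" using all eqn_coeff_2[of h k, OF h0] by simp
  moreover have "8 * h 1 * h m = rec_numerator h k m" if "m \<ge> 2" for m
    using all[rule_format, of "m + 1"] eqn_coeff_Suc[of h m k, OF h0 that] by simp
  ultimately show "h 0 = 0 \<and> (2 * h 1)\<^sup>2 = - k 0 \<and> (\<forall>m\<ge>2. 8 * h 1 * h m = rec_numerator h k m)"
    by blast
next
  assume rhs: "h 0 = 0 \<and> (2 * h 1)\<^sup>2 = - k 0 \<and> (\<forall>m\<ge>2. 8 * h 1 * h m = rec_numerator h k m)"
  show "\<forall>n. eqn_coeff h k n = 0"
  proof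
    fix n :: nat
    have "n = 0 \<or> n = 1 \<or> n = 2 \<or> (n - 1 \<ge> 2 \<and> n = (n - 1) + 1)" by arith
    then consider "n = 0" | "n = 1" | "n = 2" | m where "n = m + 1" "m \<ge> 2"
      by blast
    then show "eqn_coeff h k n = 0"
    proof cases
      case 4
      then show ?thesis using rhs eqn_coeff_Suc[of h m k] by simp
    qed (use rhs eqn_coeff_0 eqn_coeff_1 eqn_coeff_2 in simp_all)
  qed
qed

lemma forall_ge_1_split: "(\<forall>m::nat. m \<ge> 1 \<longrightarrow> P m) \<longleftrightarrow> P 1 \<and> (\<forall>m\<ge>2. P m)"
proof -
  have "m \<ge> 1 \<longleftrightarrow> m = 1 \<or> m \<ge> 2" for m :: nat by arith
  then show ?thesis by auto
qed

lemma sign_recursion_iff: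
  fixes h k :: "nat \<Rightarrow> real"
  assumes "k 0 < 0"
  shows "((2 * h 1)\<^sup>2 = - k 0 \<and> (\<forall>m\<ge>2. 8 * h 1 * h m = rec_numerator h k m)) \<longleftrightarrow>
    (\<exists>\<sigma>::real. \<sigma> \<in> {1, -1} \<and> (\<forall>m::nat. m \<ge> 1 \<longrightarrow>
       h m = \<sigma> * rec_numerator h k m / (2 ^ (2 - kdelta m 1) * sqrt (- k 0))))"
    (is "?lhs \<longleftrightarrow> (\<exists>\<sigma>. \<sigma> \<in> {1, -1} \<and> (\<forall>m. m \<ge> 1 \<longrightarrow> ?rec \<sigma> m))")
proof -
  define s where "s = sqrt (- k 0)"
  have s: "s > 0" "s\<^sup>2 = - k 0" using assms by (simp_all add: s_def)
  have rec_1: "?rec \<sigma> 1 \<longleftrightarrow> 2 * h 1 = \<sigma> * s" for \<sigma>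
  proof -
    have "rec_numerator h k 1 = s * s"
      unfolding rec_numerator_1 using s(2) by (simp add: power2_eq_square)
    moreover have "2 ^ (2 - kdelta 1 1) * sqrt (- k 0) = 2 * s" by (simp add: kdelta_def s_def)
    ultimately have "\<sigma> * rec_numerator h k 1 / (2 ^ (2 - kdelta 1 1) * sqrt (- k 0)) = \<sigma> * s / 2"
      using s(1) by simp
    then show ?thesis by linarith
  qed
  have rec_ge_2: "?rec \<sigma> m \<longleftrightarrow> 8 * h 1 * h m = rec_numerator h k m"
    if "\<sigma> \<in> {1, -1}" "2 * h 1 = \<sigma> * s" "m \<ge> 2" for \<sigma> m
  proof -
    have "2 ^ (2 - kdelta m 1) * sqrt (- k 0) = 4 * s" using that(3) by (simp add: kdelta_def s_def)
    then have "?rec \<sigma> m \<longleftrightarrow> 4 * s * h m = \<sigma> * rec_numerator h k m"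
      using s(1) by (simp add: eq_divide_eq mult.commute)
    also have "\<dots> \<longleftrightarrow> \<sigma> * (4 * s * h m) = rec_numerator h k m"
      using that(1) by auto
    also have "\<sigma> * (4 * s * h m) = 8 * h 1 * h m"
      using that(2) by simp
    finally show ?thesis .
  qed
  have "?lhs \<longleftrightarrow> (\<exists>\<sigma>\<in>{1, -1}. 2 * h 1 = \<sigma> * s) \<and> (\<forall>m\<ge>2. 8 * h 1 * h m = rec_numerator h k m)"
    unfolding s(2)[symmetric] power2_eq_iff by auto
  also have "\<dots> \<longleftrightarrow> (\<exists>\<sigma>\<in>{1, -1}. 2 * h 1 = \<sigma> * s \<and> (\<forall>m\<ge>2. ?rec \<sigma> m))"
    using rec_ge_2 by blast
  also have "\<dots> \<longleftrightarrow> (\<exists>\<sigma>. \<sigma> \<in> {1, -1} \<and> (\<forall>m. m \<ge> 1 \<longrightarrow> ?rec \<sigma> m))"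
    by (simp only: forall_ge_1_split rec_1 Bex_def conj_assoc)
  finally show ?thesis .
qed

theorem lemma1:
  fixes \<epsilon> :: real and H K :: "real \<Rightarrow> real"
  assumes "\<epsilon> > 0"
    and "real_analytic_on H {-\<epsilon><..<\<epsilon>}"
    and "real_analytic_on K {-\<epsilon><..<\<epsilon>}"
    and "K 0 < 0"
  shows "(\<forall>t. \<bar>t\<bar> < \<epsilon> \<longrightarrow> 4 * (H t)\<^sup>2 = - (t\<^sup>2 * K t)) \<longleftrightarrow>
         (H 0 = 0 \<and>
          (\<exists>\<sigma>::real. \<sigma> \<in> {1, -1} \<and>
            (\<forall>m::nat. m \<ge> 1 \<longrightarrow>
              (deriv ^^ m) H 0 =
                \<sigma> * (- (real m * (deriv ^^ (m - 1)) K 0)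
                      - 4 / real (m + 1) *
                        (\<Sum>r\<in>{2..m - 1}. real ((m + 1) choose r) *
                            (deriv ^^ r) H 0 * (deriv ^^ (m - r + 1)) H 0))
                  / (2 ^ (2 - kdelta m 1) * sqrt (- K 0)))))"
proof -
  define I where "I = {-\<epsilon><..<\<epsilon>}"
  define h where "h i = (deriv ^^ i) H 0" for i
  define k where "k i = (deriv ^^ i) K 0" for i
  have I: "open I" "connected I" "0 \<in> I"
    using assms(1) by (auto simp: I_def convex_connected)
  have k0: "k 0 < 0" using assms(4) by (simp add: k_def)
  obtain FH FK where FH: "H has_fps_expansion FH" and FK: "K has_fps_expansion FK"
    using assms(2,3) I(3) unfolding I_def real_analytic_on_iff_has_fps_expansion by fastforce
  have "(\<forall>t. \<bar>t\<bar> < \<epsilon> \<longrightarrow> 4 * (H t)\<^sup>2 = - (t\<^sup>2 * K t)) \<longleftrightarrow> (\<forall>t\<in>I. 4 * (H t)\<^sup>2 + t\<^sup>2 * K t = 0)"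
    by (auto simp: I_def abs_less_iff add_eq_0_iff)
  also have "\<dots> \<longleftrightarrow> fps_const 4 * FH\<^sup>2 + fps_X\<^sup>2 * FK = 0"
    using assms(2,3) I FH FK unfolding I_def
    by (intro real_analytic_on_eq_0_iff_fps_expansion_eq_0 fps_expansion_intros
        real_analytic_on_add real_analytic_on_mult real_analytic_on_power
        real_analytic_on_const real_analytic_on_id)
  also have "\<dots> \<longleftrightarrow> (\<forall>n. fact n * fps_nth (fps_const 4 * FH\<^sup>2 + fps_X\<^sup>2 * FK) n = 0)"
    by (simp add: fps_eq_iff)
  also have "\<dots> \<longleftrightarrow> (\<forall>n. eqn_coeff h k n = 0)"
    using fact_mult_fps_nth_eqn[of FH h FK k] FH FK
    by (simp only: fps_nth_fps_expansion_real h_def k_def)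
  also have "\<dots> \<longleftrightarrow> h 0 = 0 \<and> (\<exists>\<sigma>::real. \<sigma> \<in> {1, -1} \<and> (\<forall>m::nat. m \<ge> 1 \<longrightarrow>
       h m = \<sigma> * rec_numerator h k m / (2 ^ (2 - kdelta m 1) * sqrt (- k 0))))"
    unfolding eqn_coeffs_eq_0_iff sign_recursion_iff[of k h, OF k0] ..
  finally show ?thesis
    unfolding h_def k_def rec_numerator_def middle_sum_def funpow_0 .
qed

end
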